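(* Let each odd vertex of the diamond $D_n$ be closed with probability $p>0$ independently, and let all even vertices be open; consider Trap on the open subgraph of $D_n$. There exists a constant $C>0$ such that, if $n>(C\log p^{-1})/p$, then with high probability as $p\to0$, from every odd vertex and every protected even vertex of $D_n$, Eve wins. (That is: there is $C>0$ such that for every $\varepsilon>0$ there is $p_0\in(0,1)$ such that for all $0<p<p_0$ and all integers $n>(C\log p^{-1})/p$, the probability that Eve wins from every odd vertex and every protected even vertex of $D_n$ is at least $1-\varepsilon$.)
   Context: A vertex of $\mathbb{Z}^2$ is odd or even according to the parity of the sum of its coordinates. Adjacency in $\mathbb{Z}^2$: $u\sim v$ iff $\|u-v\|_1=1$. For an integer $n\ge1$, the diamond $D_n$ is the subgraph of $\mathbb{Z}^2$ induced by $\{u\in\mathbb{Z}^2:\|u\|_1<2n\}$. Protected vertices: let $K_0=\{(x,y)\in\mathbb{Z}^2:|y|<x\}$ and, for $k=1,2,3$, let $K_k$ be $K_0$ rotated counter-clockwise by $\pi k/2$ about the origin. A vertex $u\in D_n$ is protected if each of the cones $u+K_0,u+K_1,u+K_2,u+K_3$ contains some closed vertex of $D_n$. Trap: a token starts at an initial vertex of a graph; two players alternately move it along an incident edge to a vertex never visited before (the initial vertex counts as visited). A player who has no possible move loses and the other wins. A player "wins" from an initial vertex if she/he has a winning strategy, i.e. a strategy that results in a win whatever the opponent does. Vertices that are not closed are open; Trap on the open subgraph of $D_n$ means that moves to closed vertices and moves out of $D_n$ are forbidden. By convention the game is a first-player win if the initial vertex is closed. Odin is the player who moves from even vertices to odd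 vertices; Eve is the player who moves from odd vertices to even vertices. Thus if the initial vertex is even Odin moves first, and if it is odd Eve moves first. *)

theory Defs
  imports "HOL-Probability.Probability"
begin

type_synonym vertex = "int \<times> int"

definition l1_norm :: "vertex \<Rightarrow> int" where
  "l1_norm u = \<bar>fst u\<bar> + \<bar>snd u\<bar>"

definition adj :: "vertex \<Rightarrow> vertex \<Rightarrow> bool" where
  "adj u v \<longleftrightarrow> l1_norm (u - v) = 1"

definition odd_vertex :: "vertex \<Rightarrow> bool" where
  "odd_vertex u \<longleftrightarrow> odd (fst u + snd u)"

definition diamond :: "nat \<Rightarrow> vertex set" where
  "diamond n = {u. l1_norm u < 2 * int n}"

definition rot90 :: "vertex \<Rightarrow> vertex" where
  "rot90 u = (- snd u, fst u)"

definition cone :: "nat \<Rightarrow> vertex set" where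
  "cone k = (rot90 ^^ k) ` {(x, y). \<bar>y\<bar> < x}"

text \<open>Here and below, \<open>S\<close> is the set of closed vertices.\<close>

definition protected_vertex :: "nat \<Rightarrow> vertex set \<Rightarrow> vertex \<Rightarrow> bool" where
  "protected_vertex n S u \<longleftrightarrow>
     u \<in> diamond n \<and> (\<forall>k<4. \<exists>c \<in> diamond n \<inter> S. c \<in> (+) u ` cone k)"

text \<open>
  The game is played on the graph with vertex set \<open>V\<close> and edge relation \<open>E\<close>. A position is the
  nonempty list \<open>h\<close> of all vertices visited so far, in chronological order; the token is at
  \<open>last h\<close>, and the first player is to move iff the length of \<open>h\<close> is odd.
\<close>

datatype player = First | Second

definition to_move :: "'a list \<Rightarrow> player" where
  "to_move h = (if odd (length h) then First else Second)"

definition trap_moves :: "('a \<Rightarrow> 'a \<Rightarrow> bool) \<Rightarrow> 'a set \<Rightarrow> 'a list \<Rightarrow> 'a set" where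
  "trap_moves E V h = {w \<in> V. E (last h) w \<and> w \<notin> set h}"

text \<open>
  The positions that can arise from initial vertex \<open>v\<close> when player \<open>P\<close> uses the strategy \<open>s\<close> and
  the opponent moves arbitrarily.
\<close>

inductive trap_play ::
  "('a \<Rightarrow> 'a \<Rightarrow> bool) \<Rightarrow> 'a set \<Rightarrow> 'a \<Rightarrow> player \<Rightarrow> ('a list \<Rightarrow> 'a) \<Rightarrow> 'a list \<Rightarrow> bool"
  for E :: "'a \<Rightarrow> 'a \<Rightarrow> bool" and V :: "'a set" and v :: 'a and P :: player and s :: "'a list \<Rightarrow> 'a"
where
  start: "trap_play E V v P s [v]"
| move: "trap_play E V v P s h \<Longrightarrow> w \<in> trap_moves E V h \<Longrightarrow> (to_move h = P \<Longrightarrow> w = s h)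
    \<Longrightarrow> trap_play E V v P s (h @ [w])"

text \<open>
  A winning strategy always makes a legal move if there is one, leaves only the opponent without a
  move, and allows no infinite play (an infinite play is won by nobody; there are none if \<open>V\<close> is
  finite).
\<close>

definition winning_strategy ::
  "('a \<Rightarrow> 'a \<Rightarrow> bool) \<Rightarrow> 'a set \<Rightarrow> 'a \<Rightarrow> player \<Rightarrow> ('a list \<Rightarrow> 'a) \<Rightarrow> bool" where
  "winning_strategy E V v P s \<longleftrightarrow>
     (\<forall>h. trap_play E V v P s h \<and> to_move h = P \<and> trap_moves E V h \<noteq> {}
          \<longrightarrow> s h \<in> trap_moves E V h) \<and>
     (\<forall>h. trap_play E V v P s h \<and> trap_moves E V h = {} \<longrightarrow> to_move h \<noteq> P) \<and>
     \<not> (\<exists>f :: nat \<Rightarrow> 'a. \<forall>k. trap_play E V v P s (map f [0..<Suc k]))"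

definition trap_wins :: "('a \<Rightarrow> 'a \<Rightarrow> bool) \<Rightarrow> 'a set \<Rightarrow> 'a \<Rightarrow> player \<Rightarrow> bool" where
  "trap_wins E V v P \<longleftrightarrow> (\<exists>s. winning_strategy E V v P s)"

text \<open>By convention the first player wins from a closed initial vertex.\<close>

definition diamond_wins :: "nat \<Rightarrow> vertex set \<Rightarrow> vertex \<Rightarrow> player \<Rightarrow> bool" where
  "diamond_wins n S v P \<longleftrightarrow>
     (if v \<in> S then P = First else trap_wins adj (diamond n - S) v P)"

text \<open>
  Every move changes the parity of the vertex, so Eve, who moves from odd vertices, is the first
  player if the initial vertex is odd and the second player otherwise.
\<close>

definition eve_wins :: "nat \<Rightarrow> vertex set \<Rightarrow> vertex \<Rightarrow> bool" where
  "eve_wins n S v \<longleftrightarrow> diamond_wins n S v (if odd_vertex v then First else Second)"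

definition odd_diamond :: "nat \<Rightarrow> vertex set" where
  "odd_diamond n = {v \<in> diamond n. odd_vertex v}"

definition closed_pmf :: "nat \<Rightarrow> real \<Rightarrow> vertex set pmf" where
  "closed_pmf n p = map_pmf (\<lambda>b. {v \<in> odd_diamond n. b v})
     (Pi_pmf (odd_diamond n) False (\<lambda>_. bernoulli_pmf p))"

text \<open>
  \<^const>\<open>Pi_pmf\<close> is a product distribution only over a finite index set.
\<close>

lemma finite_diamond: "finite (diamond n)"
proof (rule finite_subset)
  show "diamond n \<subseteq> {- 2 * int n..2 * int n} \<times> {- 2 * int n..2 * int n}"
    by (auto simp: diamond_def l1_norm_def)
qed auto

lemma finite_odd_diamond: "finite (odd_diamond n)"
  using finite_diamond by (simp add: odd_diamond_def)

end

theory Submission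
  imports Defs
begin

text \<open>
  Suppose that the open odd vertices can be matched injectively with adjacent even vertices, none of
  which is the initial vertex. Then Eve wins: from an odd vertex she moves to its partner. Each even
  vertex visited so far, other than the initial one, is the partner of an odd vertex visited
  earlier, so the partner of the present vertex is still free (\<open>trap_wins_by_matching\<close>). It remains
  to find, with high probability, such a matching for each protected even vertex at once; for an odd
  initial vertex any of these matchings will do.

  In the coordinates \<open>X = x + y\<close>, \<open>Y = x - y\<close> the diamond is the square \<open>\<bar>X\<bar>, \<bar>Y\<bar> < 2n\<close>, the odd
  vertices are its points with two odd coordinates, the even vertices those with two even
  coordinates, and neighbours differ by 1 in both coordinates. One should think of odd points as
  unit cells and of even points as the corners of cells inside the square. The four cones become
  the four quadrants.

  The matching is assembled from two building blocks. If each row of a rectangle of cells contains a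
  closed cell, the cells on its left can use corners on their right and the cells on its right
  corners on their left; so every row spares a corner, and the rows may together be attached to the
  upper or to the lower side of the rectangle (\<open>matchable_rows\<close>). A rectangle with at least one closed cell
  can be matched with the corners including two adjacent sides, except for the point where these
  sides meet (\<open>matchable_corner\<close>).

  Let \<open>v\<close> be a protected vertex, by symmetry in the lower left quarter of the square. The
  horizontal and the vertical line through \<open>v\<close> cut the square into four rectangles. The lower left
  one contains a closed cell because \<open>v\<close> is protected, and takes the two arms of the cross that
  end at the left and lower sides, without \<open>v\<close>. The lower right one has long rows and takes the
  right arm; the upper left one has long columns and takes the upper arm. The upper right one must
  use interior corners only. It is divided once more into four rectangles around an interior point,
  all of which have long rows and columns, and they take one arm each in cyclic order
  (\<open>matchable_pinwheel\<close>).

  Apart from the protection of \<open>v\<close>, this needs that each row and each column of the square has a closed cell in each of four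
  segments of about a quarter of its length. The probability that this fails is at most
  \<open>32 n (1 - p)^(n div 2)\<close> by a union bound, and this is at most \<open>256 p\<close> if \<open>n > 8 ln (1/p) / p\<close>.
\<close>

section \<open>Playing along a matching\<close>

text \<open>
  \<open>M\<close> is the set of vertices from which \<open>P\<close> moves. The last conjunct is what keeps partners free: apart
  from \<open>v\<close>, the vertices outside \<open>M\<close> are entered only by \<open>P\<close>, so they are partners of vertices of \<open>M\<close> that
  the token has already left.
\<close>

lemma trap_play_invariant:
  assumes "trap_play E V v P s h" "v \<in> V"
    and move_parity: "\<And>u w. E u w \<Longrightarrow> w \<in> M \<longleftrightarrow> u \<notin> M"
    and start: "P = (if v \<in> M then First else Second)"
    and s: "\<And>h. s h = f (last h)"
  shows "h \<noteq> [] \<and> distinct h \<and> set h \<subseteq> V \<and> (to_move h = P \<longleftrightarrow> last h \<in> M) \<and>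
     (\<forall>u \<in> set h. u \<notin> M \<longrightarrow> u \<noteq> v \<longrightarrow>
        (\<exists>w \<in> set h \<inter> M. u = f w \<and> (last h \<in> M \<longrightarrow> w \<noteq> last h)))"
  using assms(1)
proof (induction rule: trap_play.induct)
  case start
  then show ?case using \<open>v \<in> V\<close> assms(4) by (auto simp: to_move_def)
next
  case (move h w)
  have w: "w \<in> V" "E (last h) w" "w \<notin> set h" using move.hyps(2) by (auto simp: trap_moves_def)
  have par: "w \<in> M \<longleftrightarrow> last h \<notin> M" using move_parity w(2) by blast
  have tm: "to_move (h @ [w]) = P \<longleftrightarrow> w \<in> M"
    using move.IH par by (cases P) (auto simp: to_move_def split: if_splits)
  have "\<exists>x \<in> set (h @ [w]) \<inter> M. u = f x \<and> (last (h @ [w]) \<in> M \<longrightarrow> x \<noteq> last (h @ [w]))"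
    if u: "u \<in> set (h @ [w])" "u \<notin> M" "u \<noteq> v" for u
  proof (cases "u = w")
    case True
    hence "last h \<in> M" "w = f (last h)" using par u(2) move.IH move.hyps(3) s by auto
    moreover have "last h \<in> set h" using move.IH by simp
    ultimately show ?thesis using True u(2) by auto
  next
    case False
    then obtain x where x: "x \<in> set h \<inter> M" "u = f x" using u move.IH by auto
    moreover have "x \<noteq> w" using x w by auto
    ultimately show ?thesis by auto
  qed
  thus ?case using tm move.IH w by auto
qed

lemma trap_wins_by_matching:
  assumes V: "finite V" "v \<in> V"
    and move_parity: "\<And>u w. E u w \<Longrightarrow> w \<in> M \<longleftrightarrow> u \<notin> M"
    and start: "P = (if v \<in> M then First else Second)"
    and inj: "inj_on f (V \<inter> M)"
    and f: "\<And>u. u \<in> V \<inter> M \<Longrightarrow> E u (f u) \<and> f u \<in> V - {v}"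
  shows "trap_wins E V v P"
proof -
  define s where "s h = f (last h)" for h
  note inv = trap_play_invariant[of E V v P s _ M f, OF _ V(2) move_parity start s_def]
  have legal: "s h \<in> trap_moves E V h" if h: "trap_play E V v P s h" "to_move h = P" for h
  proof -
    have last: "last h \<in> V \<inter> M" using inv[OF h(1)] h(2) last_in_set by blast
    have "f (last h) \<notin> set h"
    proof
      assume "f (last h) \<in> set h"
      moreover have "f (last h) \<notin> M" "f (last h) \<noteq> v" using f[OF last] move_parity last by blast+
      ultimately obtain w where "w \<in> set h \<inter> M" "f (last h) = f w" "w \<noteq> last h"
        using inv[OF h(1)] last by blast
      thus False using inj last inv[OF h(1)] unfolding inj_on_def by blast
    qed
    thus ?thesis using f[OF last] by (auto simp: s_def trap_moves_def)
  qed
  have "winning_strategy E V v P s"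
    unfolding winning_strategy_def
  proof (intro conjI allI impI notI)
    fix h assume "trap_play E V v P s h \<and> trap_moves E V h = {}" "to_move h = P"
    thus False using legal by auto
  next
    \<comment> \<open>An infinite play would visit infinitely many vertices of the finite set \<open>V\<close>.\<close>
    assume "\<exists>g :: nat \<Rightarrow> _. \<forall>k. trap_play E V v P s (map g [0..<Suc k])"
    then obtain g where g: "trap_play E V v P s (map g [0..<Suc k])" for k by blast
    have "distinct (map g [0..<Suc (card V)])" "set (map g [0..<Suc (card V)]) \<subseteq> V"
      using inv[OF g] by blast+
    hence "length (map g [0..<Suc (card V)]) \<le> card V"
      using V(1) by (metis card_mono distinct_card)
    thus False by simp
  qed (use legal in blast)
  thus ?thesis unfolding trap_wins_def by blast
qed

section \<open>Matchings between odd and even points\<close>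

definition diag_adj :: "int \<times> int \<Rightarrow> int \<times> int \<Rightarrow> bool" where
  "diag_adj u w \<longleftrightarrow> \<bar>fst u - fst w\<bar> = 1 \<and> \<bar>snd u - snd w\<bar> = 1"

definition odd_pts :: "int set \<Rightarrow> int set \<Rightarrow> (int \<times> int) set" where
  "odd_pts I J = {(X, Y). X \<in> I \<and> Y \<in> J \<and> odd X \<and> odd Y}"

definition even_pts :: "int set \<Rightarrow> int set \<Rightarrow> (int \<times> int) set" where
  "even_pts I J = {(X, Y). X \<in> I \<and> Y \<in> J \<and> even X \<and> even Y}"

text \<open>
  \<open>C\<close> is the set of closed points. Only the open points of \<open>A\<close> receive partners, and the partners lie
  in \<open>B\<close>.
\<close>

definition matchable ::
  "(int \<times> int) set \<Rightarrow> (int \<times> int) set \<Rightarrow> (int \<times> int) set \<Rightarrow> bool" where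
  "matchable C A B \<longleftrightarrow>
     (\<exists>f. inj_on f (A - C) \<and> (\<forall>u \<in> A - C. f u \<in> B \<and> diag_adj u (f u)))"

lemma matchable_mono:
  assumes "matchable C A B" "A' \<subseteq> A" "B \<subseteq> B'"
  shows "matchable C A' B'"
proof -
  from assms(1) obtain f where "inj_on f (A - C)" "\<forall>u \<in> A - C. f u \<in> B \<and> diag_adj u (f u)"
    unfolding matchable_def by blast
  moreover have "A' - C \<subseteq> A - C" using assms(2) by blast
  ultimately show ?thesis unfolding matchable_def using assms(3)
    by (intro exI[of _ f]) (meson inj_on_subset subsetD)
qed

text \<open>
  This is the way to put matchings of rectangles together: it is enough that the rectangles cover the
  points in question and that the corners assigned to them are disjoint.
\<close>

lemma matchable_Un:
  assumes "matchable C A B" "matchable C A' B'" "B \<inter> B' = {}"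
  shows "matchable C (A \<union> A') (B \<union> B')"
proof -
  from assms(1) obtain f where f: "inj_on f (A - C)" "\<forall>u \<in> A - C. f u \<in> B \<and> diag_adj u (f u)"
    unfolding matchable_def by blast
  from assms(2) obtain g where g: "inj_on g (A' - C)" "\<forall>u \<in> A' - C. g u \<in> B' \<and> diag_adj u (g u)"
    unfolding matchable_def by blast
  let ?h = "\<lambda>u. if u \<in> A then f u else g u"
  have "inj_on ?h (A \<union> A' - C)"
  proof (rule inj_onI)
    fix u w assume uw: "u \<in> A \<union> A' - C" "w \<in> A \<union> A' - C" "?h u = ?h w"
    have "?h x \<in> (if x \<in> A then B else B')" if "x \<in> A \<union> A' - C" for x using that f g by auto
    hence "u \<in> A \<longleftrightarrow> w \<in> A" using uw assms(3) by (metis IntI emptyE)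
    thus "u = w" using uw f(1) g(1) by (auto split: if_splits dest: inj_onD)
  qed
  moreover have "\<forall>u \<in> A \<union> A' - C. ?h u \<in> B \<union> B' \<and> diag_adj u (?h u)"
    using f g by auto
  ultimately show ?thesis unfolding matchable_def by blast
qed

lemma matchable_symmetry:
  assumes "bij \<sigma>" and adj: "\<And>u w. diag_adj (\<sigma> u) (\<sigma> w) \<longleftrightarrow> diag_adj u w"
    and "matchable (\<sigma> -` C) (\<sigma> -` A) (\<sigma> -` B)"
  shows "matchable C A B"
proof -
  from assms(3) obtain f where f: "inj_on f (\<sigma> -` A - \<sigma> -` C)"
      "\<forall>u \<in> \<sigma> -` A - \<sigma> -` C. f u \<in> \<sigma> -` B \<and> diag_adj u (f u)"
    unfolding matchable_def by blast
  let ?g = "\<lambda>u. \<sigma> (f (inv \<sigma> u))"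
  have inv: "\<sigma> (inv \<sigma> u) = u" for u using \<open>bij \<sigma>\<close> by (simp add: bij_is_surj surj_f_inv_f)
  have mem: "inv \<sigma> u \<in> \<sigma> -` A - \<sigma> -` C" if "u \<in> A - C" for u using that inv by simp
  have "inj_on ?g (A - C)"
  proof (rule inj_onI)
    fix u w assume uw: "u \<in> A - C" "w \<in> A - C" "?g u = ?g w"
    hence "f (inv \<sigma> u) = f (inv \<sigma> w)" using \<open>bij \<sigma>\<close> by (simp add: bij_is_inj inj_eq)
    hence "inv \<sigma> u = inv \<sigma> w" using f(1) mem uw by (meson inj_onD)
    thus "u = w" by (metis inv)
  qed
  moreover have "?g u \<in> B \<and> diag_adj u (?g u)" if "u \<in> A - C" for u
    using f(2) mem[OF that] adj[of "inv \<sigma> u" "f (inv \<sigma> u)"] inv by auto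
  ultimately show ?thesis unfolding matchable_def by blast
qed

section \<open>Matchings of rectangles\<close>

lemma matchable_shift:
  assumes "s \<in> {1, -1}" "t \<in> {1, -1}"
  shows "matchable C (odd_pts I J) (even_pts {x. x - s \<in> I} {y. y - t \<in> J})"
  unfolding matchable_def
  by (rule exI[of _ "\<lambda>(X, Y). (s + X, t + Y)"])
     (use assms in \<open>auto simp: inj_on_def odd_pts_def even_pts_def diag_adj_def\<close>)

text \<open>
  In each row the closed point separates the points that step to the right from those that step to
  the left, so that no partner leaves the interval \<open>{x0<..<x1}\<close>. The rows all move in the
  vertical direction \<open>s\<close>, hence different rows do not interfere.
\<close>

lemma matchable_rows:
  assumes hit: "\<And>Y. Y \<in> J \<Longrightarrow> odd Y \<Longrightarrow> \<exists>X \<in> {x0<..<x1}. odd X \<and> (X, Y) \<in> C"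
    and s: "s \<in> {1, -1}"
  shows "matchable C (odd_pts {x0<..<x1} J) (even_pts {x0<..<x1} {y. y - s \<in> J})"
proof -
  obtain c where c: "c Y \<in> {x0<..<x1}" "odd (c Y)" "(c Y, Y) \<in> C"
    if "Y \<in> J" "odd Y" for Y using hit by metis
  let ?f = "\<lambda>(X, Y). (if X < c Y then X + 1 else X - 1, s + Y)"
  have "inj_on ?f (odd_pts {x0<..<x1} J - C)"
  proof (rule inj_onI)
    fix u u' assume u: "u \<in> odd_pts {x0<..<x1} J - C" "u' \<in> odd_pts {x0<..<x1} J - C" "?f u = ?f u'"
    obtain X Y X' Y' where uXY: "u = (X, Y)" "u' = (X', Y')" by force
    hence "Y' = Y" using u by simp
    have "X \<noteq> c Y" "X' \<noteq> c Y" "odd X" "odd X'" "odd (c Y)"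
      using u c[of Y] \<open>Y' = Y\<close> by (auto simp: uXY odd_pts_def)
    have "(if X < c Y then X + 1 else X - 1) = (if X' < c Y then X' + 1 else X' - 1)"
      using u(3) \<open>Y' = Y\<close> by (simp add: uXY)
    hence "X = X'" using \<open>X \<noteq> c Y\<close> \<open>X' \<noteq> c Y\<close> \<open>odd X\<close> \<open>odd X'\<close> \<open>odd (c Y)\<close>
      by presburger
    thus "u = u'" using \<open>Y' = Y\<close> uXY by simp
  qed
  moreover have "?f u \<in> even_pts {x0<..<x1} {y. y - s \<in> J} \<and> diag_adj u (?f u)"
    if "u \<in> odd_pts {x0<..<x1} J - C" for u
  proof -
    obtain X Y where u: "u = (X, Y)" by force
    have "X \<noteq> c Y" "c Y \<in> {x0<..<x1}" using that c[of Y] by (auto simp: u odd_pts_def)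
    with that s show ?thesis by (auto simp: u odd_pts_def even_pts_def diag_adj_def)
  qed
  ultimately show ?thesis unfolding matchable_def by blast
qed

lemma matchable_columns:
  assumes hit: "\<And>X. X \<in> I \<Longrightarrow> odd X \<Longrightarrow> \<exists>Y \<in> {y0<..<y1}. odd Y \<and> (X, Y) \<in> C"
    and s: "s \<in> {1, -1}"
  shows "matchable C (odd_pts I {y0<..<y1}) (even_pts {x. x - s \<in> I} {y0<..<y1})"
proof (rule matchable_symmetry[of prod.swap])
  have "matchable (prod.swap -` C) (odd_pts {y0<..<y1} I) (even_pts {y0<..<y1} {x. x - s \<in> I})"
    by (rule matchable_rows) (use assms in auto)
  thus "matchable (prod.swap -` C) (prod.swap -` odd_pts I {y0<..<y1})
          (prod.swap -` even_pts {x. x - s \<in> I} {y0<..<y1})"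
    by (rule matchable_mono) (auto simp: odd_pts_def even_pts_def)
qed (auto simp: diag_adj_def)

text \<open>
  The four rectangles around \<open>(cx, cy)\<close> are matched by rows, columns, rows, columns in cyclic order.
  Each of them claims exactly one of the four arms of the cross through \<open>(cx, cy)\<close>, and none claims
  a point on the boundary of the box.
\<close>

lemma matchable_pinwheel:
  assumes c: "even cx" "even cy"  "x0 < cx" "cx < x1" "y0 < cy" "cy < y1"
    and hits: "\<And>Y. Y \<in> {cy<..<y1} \<Longrightarrow> odd Y \<Longrightarrow> \<exists>X \<in> {cx<..<x1}. odd X \<and> (X, Y) \<in> C"
      "\<And>X. X \<in> {x0<..<cx} \<Longrightarrow> odd X \<Longrightarrow> \<exists>Y \<in> {cy<..<y1}. odd Y \<and> (X, Y) \<in> C"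
      "\<And>Y. Y \<in> {y0<..<cy} \<Longrightarrow> odd Y \<Longrightarrow> \<exists>X \<in> {x0<..<cx}. odd X \<and> (X, Y) \<in> C"
      "\<And>X. X \<in> {cx<..<x1} \<Longrightarrow> odd X \<Longrightarrow> \<exists>Y \<in> {y0<..<cy}. odd Y \<and> (X, Y) \<in> C"
  shows "matchable C (odd_pts {x0<..<x1} {y0<..<y1}) (even_pts {x0<..<x1} {y0<..<y1})"
proof -
  have Q1: "matchable C (odd_pts {cx<..<x1} {cy<..<y1}) (even_pts {cx<..<x1} {cy..<y1})"
    by (rule matchable_mono[OF matchable_rows[of "{cy<..<y1}" cx x1 C "-1", OF hits(1)]])
      (use c in \<open>auto simp: even_pts_def\<close>)
  have Q2: "matchable C (odd_pts {x0<..<cx} {cy<..<y1}) (even_pts {x0<..cx} {cy<..<y1})"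
    by (rule matchable_mono[OF matchable_columns[of "{x0<..<cx}" cy y1 C 1, OF hits(2)]])
      (use c in \<open>auto simp: even_pts_def\<close>)
  have Q3: "matchable C (odd_pts {x0<..<cx} {y0<..<cy}) (even_pts {x0<..<cx} {y0<..cy})"
    by (rule matchable_mono[OF matchable_rows[of "{y0<..<cy}" x0 cx C 1, OF hits(3)]])
      (use c in \<open>auto simp: even_pts_def\<close>)
  have Q4: "matchable C (odd_pts {cx<..<x1} {y0<..<cy}) (even_pts {cx..<x1} {y0<..<cy})"
    by (rule matchable_mono[OF matchable_columns[of "{cx<..<x1}" y0 cy C "-1", OF hits(4)]])
      (use c in \<open>auto simp: even_pts_def\<close>)
  have cover: "odd_pts {x0<..<x1} {y0<..<y1} \<subseteq> odd_pts {cx<..<x1} {cy<..<y1} \<union>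
      (odd_pts {x0<..<cx} {cy<..<y1} \<union> (odd_pts {x0<..<cx} {y0<..<cy} \<union> odd_pts {cx<..<x1} {y0<..<cy}))"
  proof
    fix u assume u: "u \<in> odd_pts {x0<..<x1} {y0<..<y1}"
    obtain X Y where [simp]: "u = (X, Y)" by force
    have "X \<noteq> cx" "Y \<noteq> cy" using u c(1,2) by (auto simp: odd_pts_def)
    thus "u \<in> odd_pts {cx<..<x1} {cy<..<y1} \<union> (odd_pts {x0<..<cx} {cy<..<y1} \<union>
        (odd_pts {x0<..<cx} {y0<..<cy} \<union> odd_pts {cx<..<x1} {y0<..<cy}))"
      using u by (cases "X < cx"; cases "Y < cy") (simp_all add: odd_pts_def)
  qed
  show ?thesis
  proof (rule matchable_mono[OF matchable_Un[OF Q1 matchable_Un[OF Q2 matchable_Un[OF Q3 Q4]]] cover])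
    show "even_pts {x0<..<cx} {y0<..cy} \<inter> even_pts {cx..<x1} {y0<..<cy} = {}"
      by (auto simp: even_pts_def)
    show "even_pts {x0<..cx} {cy<..<y1} \<inter>
        (even_pts {x0<..<cx} {y0<..cy} \<union> even_pts {cx..<x1} {y0<..<cy}) = {}"
      by (auto simp: even_pts_def)
    show "even_pts {cx<..<x1} {cy..<y1} \<inter> (even_pts {x0<..cx} {cy<..<y1} \<union>
        (even_pts {x0<..<cx} {y0<..cy} \<union> even_pts {cx..<x1} {y0<..<cy})) = {}"
      by (auto simp: even_pts_def)
    show "even_pts {cx<..<x1} {cy..<y1} \<union> (even_pts {x0<..cx} {cy<..<y1} \<union>
        (even_pts {x0<..<cx} {y0<..cy} \<union> even_pts {cx..<x1} {y0<..<cy}))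
        \<subseteq> even_pts {x0<..<x1} {y0<..<y1}"
      unfolding even_pts_def using c by auto
  qed
qed

text \<open>
  If no point were closed, the step \<open>(1, 1)\<close> would use all corners, including \<open>(a, b)\<close>. The closed point \<open>(i, j)\<close>
  frees its own corner, and this vacancy is carried to \<open>(a, b)\<close>: first along row \<open>j\<close> to the right,
  then along the last column upwards.
\<close>

lemma matchable_corner:
  assumes "even a" "even b"
    and ij: "(i, j) \<in> C" "odd i" "odd j" "i \<in> {x0<..<a}" "j \<in> {y0<..<b}"
  shows "matchable C (odd_pts {x0<..<a} {y0<..<b}) (even_pts {x0<..a} {y0<..b} - {(a, b)})"
proof -
  have not_j: "y \<noteq> j" if "even y" for y using that ij(3) by blast
  have below: "matchable C (odd_pts {x0<..<a} {y0<..<j}) (even_pts {x0<..a} {y0<..<j})"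
  proof (rule matchable_mono[OF matchable_shift[of 1 1 C "{x0<..<a}" "{y0<..<j}"]])
    show "even_pts {x. x - 1 \<in> {x0<..<a}} {y. y - 1 \<in> {y0<..<j}} \<subseteq> even_pts {x0<..a} {y0<..<j}"
      using not_j by (force simp: even_pts_def)
  qed auto
  have row: "matchable C (odd_pts {x0<..<a} {j}) (even_pts {x0<..<a} {j + 1})"
  proof (rule matchable_mono[OF matchable_rows[of "{j}" x0 a C 1]])
    show "\<exists>X \<in> {x0<..<a}. odd X \<and> (X, Y) \<in> C" if "Y \<in> {j}" for Y
      using that ij by auto
  qed (auto simp: even_pts_def)
  have above: "matchable C (odd_pts {x0<..<a - 1} {j<..<b}) (even_pts {x0<..<a} {j + 1<..b})"
    by (rule matchable_mono[OF matchable_shift[of 1 1 C "{x0<..<a - 1}" "{j<..<b}"]])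
      (auto simp: even_pts_def)
  have edge: "matchable C (odd_pts {a - 1} {j<..<b}) (even_pts {a} {j<..<b})"
  proof (rule matchable_mono[OF matchable_shift[of 1 "-1" C "{a - 1}" "{j<..<b}"]])
    show "even_pts {x. x - 1 \<in> {a - 1}} {y. y - -1 \<in> {j<..<b}} \<subseteq> even_pts {a} {j<..<b}"
      using not_j by (force simp: even_pts_def)
  qed auto
  have cover: "odd_pts {x0<..<a} {y0<..<b} \<subseteq> odd_pts {x0<..<a} {y0<..<j} \<union>
      (odd_pts {x0<..<a} {j} \<union> (odd_pts {x0<..<a - 1} {j<..<b} \<union> odd_pts {a - 1} {j<..<b}))"
  proof
    fix u assume u: "u \<in> odd_pts {x0<..<a} {y0<..<b}"
    obtain X Y where [simp]: "u = (X, Y)" by force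
    show "u \<in> odd_pts {x0<..<a} {y0<..<j} \<union>
      (odd_pts {x0<..<a} {j} \<union> (odd_pts {x0<..<a - 1} {j<..<b} \<union> odd_pts {a - 1} {j<..<b}))"
      using u by (cases "X < a - 1"; cases Y j rule: linorder_cases) (simp_all add: odd_pts_def)
  qed
  show ?thesis
    by (rule matchable_mono[OF matchable_Un[OF below matchable_Un[OF row matchable_Un[OF above edge]]] cover])
       (use ij in \<open>auto simp: even_pts_def\<close>)
qed

section \<open>Matchings of the square\<close>

text \<open>
  Each row and each column of the square has a closed point in each of the four segments of length
  \<open>2 q\<close> on both sides of its midpoint. The segments are placed symmetrically, so that the condition
  is invariant under reflections.
\<close>

definition well_hit :: "int \<Rightarrow> int \<Rightarrow> (int \<times> int) set \<Rightarrow> bool" where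
  "well_hit q N C \<longleftrightarrow> (\<forall>z k. odd z \<longrightarrow> \<bar>z\<bar> < N \<longrightarrow> k \<in> {-2, -1, 0, 1} \<longrightarrow>
     (\<exists>w \<in> {2 * q * k<..<2 * q * (k + 1)}. odd w \<and> (w, z) \<in> C) \<and>
     (\<exists>w \<in> {2 * q * k<..<2 * q * (k + 1)}. odd w \<and> (z, w) \<in> C))"


lemma well_hit_row:
  assumes "well_hit q N C" "odd Y" "\<bar>Y\<bar> < N" "k \<in> {-2, -1, 0, 1}"
    and "x0 \<le> 2 * q * k" "2 * q * (k + 1) \<le> x1"
  shows "\<exists>X \<in> {x0<..<x1}. odd X \<and> (X, Y) \<in> C"
proof -
  obtain X where "X \<in> {2 * q * k<..<2 * q * (k + 1)}" "odd X" "(X, Y) \<in> C"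
    using assms(1-4) unfolding well_hit_def by blast
  thus ?thesis using assms(5,6) by (intro bexI[of _ X]) auto
qed

lemma well_hit_column:
  assumes "well_hit q N C" "odd X" "\<bar>X\<bar> < N" "k \<in> {-2, -1, 0, 1}"
    and "y0 \<le> 2 * q * k" "2 * q * (k + 1) \<le> y1"
  shows "\<exists>Y \<in> {y0<..<y1}. odd Y \<and> (X, Y) \<in> C"
proof -
  obtain Y where "Y \<in> {2 * q * k<..<2 * q * (k + 1)}" "odd Y" "(X, Y) \<in> C"
    using assms(1-4) unfolding well_hit_def by blast
  thus ?thesis using assms(5,6) by (intro bexI[of _ Y]) auto
qed

text \<open>
  The cross through \<open>(a, b)\<close> is shared out among three of the four rectangles that it cuts off. Since
  \<open>a, b \<le> 0\<close>, the rows of the lower right and the columns of the upper left rectangle contain the whole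
  segment from \<open>0\<close> to \<open>2 q\<close>. The upper right rectangle contains this segment and the next one in both
  directions, which allows a pinwheel around \<open>(2 q, 2 q)\<close>. The lower left rectangle may be arbitrarily
  small; there the point \<open>(i, j)\<close> is the only one known to be closed.
\<close>

lemma matchable_lower_left:
  assumes hit: "well_hit q N C" and q: "0 < q" "4 * q \<le> N"
    and ab: "even a" "even b" "- N < a" "a \<le> 0" "- N < b" "b \<le> 0"
    and ij: "(i, j) \<in> C" "odd i" "odd j" "i \<in> {- N<..<a}" "j \<in> {- N<..<b}"
  shows "matchable C (odd_pts {- N<..<N} {- N<..<N}) (even_pts {- N<..<N} {- N<..<N} - {(a, b)})"
proof -
  have Q1: "matchable C (odd_pts {a<..<N} {b<..<N}) (even_pts {a<..<N} {b<..<N})"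
  proof (rule matchable_pinwheel[of "2 * q" "2 * q"])
    show "\<exists>X \<in> {2 * q<..<N}. odd X \<and> (X, Y) \<in> C" if "Y \<in> {2 * q<..<N}" "odd Y" for Y
      by (rule well_hit_row[OF hit, where k = 1]) (use that q ab in auto)
    show "\<exists>Y \<in> {2 * q<..<N}. odd Y \<and> (X, Y) \<in> C" if "X \<in> {a<..<2 * q}" "odd X" for X
      by (rule well_hit_column[OF hit, where k = 1]) (use that q ab in auto)
    show "\<exists>X \<in> {a<..<2 * q}. odd X \<and> (X, Y) \<in> C" if "Y \<in> {b<..<2 * q}" "odd Y" for Y
      by (rule well_hit_row[OF hit, where k = 0]) (use that q ab in auto)
    show "\<exists>Y \<in> {b<..<2 * q}. odd Y \<and> (X, Y) \<in> C" if "X \<in> {2 * q<..<N}" "odd X" for X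
      by (rule well_hit_column[OF hit, where k = 0]) (use that q ab in auto)
  qed (use q ab in auto)
  have Q2: "matchable C (odd_pts {- N<..<a} {b<..<N}) (even_pts {- N<..a} {b<..<N})"
  proof (rule matchable_mono[OF matchable_columns[of "{- N<..<a}" b N C 1]])
    show "\<exists>Y \<in> {b<..<N}. odd Y \<and> (X, Y) \<in> C" if "X \<in> {- N<..<a}" "odd X" for X
      by (rule well_hit_column[OF hit, where k = 0]) (use that q ab in auto)
  qed (auto simp: even_pts_def)
  have Q4: "matchable C (odd_pts {a<..<N} {- N<..<b}) (even_pts {a<..<N} {- N<..b})"
  proof (rule matchable_mono[OF matchable_rows[of "{- N<..<b}" a N C 1]])
    show "\<exists>X \<in> {a<..<N}. odd X \<and> (X, Y) \<in> C" if "Y \<in> {- N<..<b}" "odd Y" for Y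
      by (rule well_hit_row[OF hit, where k = 0]) (use that q ab in auto)
  qed (auto simp: even_pts_def)
  note Q3 = matchable_corner[OF ab(1,2) ij]
  have cover: "odd_pts {- N<..<N} {- N<..<N} \<subseteq> odd_pts {a<..<N} {b<..<N} \<union>
      (odd_pts {- N<..<a} {b<..<N} \<union> (odd_pts {- N<..<a} {- N<..<b} \<union> odd_pts {a<..<N} {- N<..<b}))"
  proof
    fix u assume u: "u \<in> odd_pts {- N<..<N} {- N<..<N}"
    obtain X Y where [simp]: "u = (X, Y)" by force
    have "X \<noteq> a" "Y \<noteq> b" using u ab(1,2) by (auto simp: odd_pts_def)
    thus "u \<in> odd_pts {a<..<N} {b<..<N} \<union>
      (odd_pts {- N<..<a} {b<..<N} \<union> (odd_pts {- N<..<a} {- N<..<b} \<union> odd_pts {a<..<N} {- N<..<b}))"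
      using u by (cases "X < a"; cases "Y < b") (simp_all add: odd_pts_def)
  qed
  show ?thesis
    by (rule matchable_mono[OF matchable_Un[OF Q1 matchable_Un[OF Q2 matchable_Un[OF Q3 Q4]]] cover])
       (use q ab in \<open>auto simp: even_pts_def\<close>)
qed

lemma well_hit_reflect:
  assumes hit: "well_hit q N C" and s: "s \<in> {1, -1}" and t: "t \<in> {1, -1}"
  shows "well_hit q N ((\<lambda>(X, Y). (s * X, t * Y)) -` C)"
  unfolding well_hit_def
proof (intro allI impI)
  fix z k :: int assume z: "odd z" "\<bar>z\<bar> < N" and k: "k \<in> {-2, -1, 0, 1}"
  \<comment> \<open>Reflection turns segment \<open>k\<close> into segment \<open>- k - 1\<close>.\<close>
  define k' where "k' r = (if r = 1 then k else - k - 1)" for r :: int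
  have k': "k' r \<in> {-2, -1, 0, 1}" for r using k by (auto simp: k'_def)
  have seg: "r * w \<in> {2 * q * k<..<2 * q * (k + 1)} \<and> r * (r * w) = w \<and> (odd (r * w) \<longleftrightarrow> odd w)"
    if "w \<in> {2 * q * k' r<..<2 * q * (k' r + 1)}" and "r \<in> {1, -1}" for r w
  proof (cases "r = 1")
    case False
    hence "r = -1" using that by simp
    thus ?thesis using that by (simp add: k'_def algebra_simps)
  qed (use that in \<open>simp add: k'_def\<close>)
  have rz: "odd (r * z)" "\<bar>r * z\<bar> < N" if "r \<in> {1, -1}" for r using z that by auto
  obtain x where x: "x \<in> {2 * q * k' s<..<2 * q * (k' s + 1)}" "odd x" "(x, t * z) \<in> C"
    using hit rz[OF t] k'[of s] unfolding well_hit_def by blast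
  obtain y where y: "y \<in> {2 * q * k' t<..<2 * q * (k' t + 1)}" "odd y" "(s * z, y) \<in> C"
    using hit rz[OF s] k'[of t] unfolding well_hit_def by blast
  have "s * (s * x) = x" "t * (t * y) = y" using seg[OF x(1) s] seg[OF y(1) t] by blast+
  hence "(s * x, z) \<in> (\<lambda>(X, Y). (s * X, t * Y)) -` C" "(z, t * y) \<in> (\<lambda>(X, Y). (s * X, t * Y)) -` C"
    using x(3) y(3) by (simp_all only: vimage_eq case_prod_conv)
  thus "(\<exists>w \<in> {2 * q * k<..<2 * q * (k + 1)}. odd w \<and> (w, z) \<in> (\<lambda>(X, Y). (s * X, t * Y)) -` C) \<and>
        (\<exists>w \<in> {2 * q * k<..<2 * q * (k + 1)}. odd w \<and> (z, w) \<in> (\<lambda>(X, Y). (s * X, t * Y)) -` C)"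
    using seg[OF x(1) s] seg[OF y(1) t] x(2) y(2) by blast
qed

text \<open>
  A reflection in the axes moves the point into the lower left quarter of the square.
\<close>

lemma matchable_avoiding:
  assumes hit: "well_hit q N C" and q: "0 < q" "4 * q \<le> N"
    and C: "C \<subseteq> odd_pts {- N<..<N} {- N<..<N}"
    and ab: "(a, b) \<in> even_pts {- N<..<N} {- N<..<N}"
    and quadrants: "\<And>s t. s \<in> {1, -1} \<Longrightarrow> t \<in> {1, -1} \<Longrightarrow> \<exists>(i, j) \<in> C. s * i < s * a \<and> t * j < t * b"
  shows "matchable C (odd_pts {- N<..<N} {- N<..<N}) (even_pts {- N<..<N} {- N<..<N} - {(a, b)})"
proof -
  define s t :: int where "s = (if a \<le> 0 then 1 else -1)" and "t = (if b \<le> 0 then 1 else -1)"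
  have st: "s \<in> {1, -1}" "t \<in> {1, -1}" by (auto simp: s_def t_def)
  define \<sigma> where "\<sigma> = (\<lambda>(X, Y). (s * X, t * Y))"
  have \<sigma>\<sigma>: "\<sigma> (\<sigma> u) = u" for u using st by (auto simp: \<sigma>_def split: prod.splits)
  obtain i j where ij: "(i, j) \<in> C" "s * i < s * a" "t * j < t * b"
    using quadrants[OF st] by auto
  have "matchable (\<sigma> -` C) (odd_pts {- N<..<N} {- N<..<N})
          (even_pts {- N<..<N} {- N<..<N} - {(s * a, t * b)})"
  proof (rule matchable_lower_left[of q N _ "s * a" "t * b" "s * i" "t * j"])
    show "well_hit q N (\<sigma> -` C)" unfolding \<sigma>_def by (rule well_hit_reflect[OF hit st])
    show "(s * i, t * j) \<in> \<sigma> -` C" using ij(1) st by (auto simp: \<sigma>_def)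
  qed (use st q ab ij C in \<open>auto simp: s_def t_def even_pts_def odd_pts_def\<close>)
  hence "matchable (\<sigma> -` C) (\<sigma> -` odd_pts {- N<..<N} {- N<..<N})
          (\<sigma> -` (even_pts {- N<..<N} {- N<..<N} - {(a, b)}))"
    by (rule matchable_mono) (use st in \<open>auto simp: \<sigma>_def odd_pts_def even_pts_def\<close>)
  thus ?thesis
  proof (rule matchable_symmetry[rotated 2])
    show "bij \<sigma>" using \<sigma>\<sigma> by (metis bijI')
    show "diag_adj (\<sigma> u) (\<sigma> w) = diag_adj u w" for u w
      using st by (auto simp: \<sigma>_def diag_adj_def split: prod.splits)
  qed
qed

section \<open>The diamond in diagonal coordinates\<close>

text \<open>
  These coordinates turn the diamond into a square and the cones into quadrants.
\<close>

definition diag :: "vertex \<Rightarrow> int \<times> int" where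
  "diag u = (fst u + snd u, fst u - snd u)"

text \<open>
  The image of \<open>diag\<close> consists of the points whose coordinates have equal parity; on other points the value
  is arbitrary.
\<close>

definition undiag :: "int \<times> int \<Rightarrow> vertex" where
  "undiag P = ((fst P + snd P) div 2, (fst P - snd P) div 2)"

lemma diag_undiag: "even (fst P + snd P) \<Longrightarrow> diag (undiag P) = P"
  by (cases P) (auto simp: diag_def undiag_def elim!: evenE, presburger+)

lemma undiag_diag: "undiag (diag u) = u"
  by (simp add: diag_def undiag_def)

lemma adj_diag: "adj u w \<longleftrightarrow> diag_adj (diag u) (diag w)"
proof -
  have "\<bar>x\<bar> + \<bar>y\<bar> = 1 \<longleftrightarrow> \<bar>x + y\<bar> = 1 \<and> \<bar>x - y\<bar> = 1" for x y :: int by arith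
  from this[of "fst u - fst w" "snd u - snd w"] show ?thesis
    by (simp add: adj_def l1_norm_def diag_adj_def diag_def algebra_simps)
qed

abbreviation width :: "nat \<Rightarrow> int set" where
  "width n \<equiv> {- (2 * int n)<..<2 * int n}"

lemma odd_diamond_diag: "u \<in> odd_diamond n \<longleftrightarrow> diag u \<in> odd_pts (width n) (width n)"
  by (cases u) (auto simp: odd_diamond_def diamond_def l1_norm_def odd_vertex_def odd_pts_def diag_def)

lemma even_diamond_diag:
  "u \<in> diamond n \<and> \<not> odd_vertex u \<longleftrightarrow> diag u \<in> even_pts (width n) (width n)"
  by (cases u) (auto simp: diamond_def l1_norm_def odd_vertex_def even_pts_def diag_def)

text \<open>
  From an odd vertex any matching is good enough, as the initial vertex is not even; otherwise \<open>w\<close>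
  has to be the initial vertex.
\<close>

lemma eve_wins_by_matching:
  assumes S: "S \<subseteq> odd_diamond n" and v: "v \<in> diamond n" "odd_vertex v \<or> diag v = w"
    and "matchable (diag ` S) (odd_pts (width n) (width n)) (even_pts (width n) (width n) - {w})"
  shows "eve_wins n S v"
proof -
  let ?O = "odd_pts (width n) (width n)" and ?E = "even_pts (width n) (width n)"
  let ?M = "Collect odd_vertex"
  from assms(4) obtain g where g: "inj_on g (?O - diag ` S)"
      "\<And>P. P \<in> ?O - diag ` S \<Longrightarrow> g P \<in> ?E - {w} \<and> diag_adj P (g P)"
    unfolding matchable_def by blast
  define f where "f u = undiag (g (diag u))" for u
  have inS: "diag u \<in> diag ` S \<longleftrightarrow> u \<in> S" for u by (metis image_iff undiag_diag)
  have dom: "diag u \<in> ?O - diag ` S" if "u \<in> (diamond n - S) \<inter> ?M" for u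
    using that odd_diamond_diag[of u n] inS by (auto simp: odd_diamond_def)
  have diag_f: "diag (f u) = g (diag u)" if "u \<in> (diamond n - S) \<inter> ?M" for u
    unfolding f_def by (rule diag_undiag) (use g(2)[OF dom[OF that]] in \<open>auto simp: even_pts_def\<close>)
  have "trap_wins adj (diamond n - S) v (if odd_vertex v then First else Second)" if "v \<notin> S"
  proof (rule trap_wins_by_matching[where M = ?M and f = f])
    show "finite (diamond n - S)" by (simp add: finite_diamond)
    show "v \<in> diamond n - S" using v that by simp
    show "x \<in> ?M \<longleftrightarrow> u \<notin> ?M" if "adj u x" for u x
      using that by (cases u; cases x) (auto simp: adj_def l1_norm_def odd_vertex_def, presburger+)
    show "inj_on f ((diamond n - S) \<inter> ?M)"
    proof (rule inj_onI)
      fix u x assume ux: "u \<in> (diamond n - S) \<inter> ?M" "x \<in> (diamond n - S) \<inter> ?M" "f u = f x"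
      hence "g (diag u) = g (diag x)" using diag_f by metis
      hence "diag u = diag x" using g(1) dom ux by (meson inj_onD)
      thus "u = x" by (metis undiag_diag)
    qed
    show "adj u (f u) \<and> f u \<in> diamond n - S - {v}" if u: "u \<in> (diamond n - S) \<inter> ?M" for u
    proof -
      have gu: "diag (f u) \<in> ?E" "diag (f u) \<noteq> w" "diag_adj (diag u) (diag (f u))"
        using g(2)[OF dom[OF u]] diag_f[OF u] by auto
      have fu: "f u \<in> diamond n" "\<not> odd_vertex (f u)" using gu(1) even_diamond_diag by blast+
      moreover have "f u \<notin> S" using S fu(2) by (auto simp: odd_diamond_def)
      moreover have "f u \<noteq> v" using v(2) gu(2) fu(2) by blast
      ultimately show ?thesis using gu(3) adj_diag by blast
    qed
  qed simp
  thus ?thesis using S by (auto simp: eve_wins_def diamond_wins_def odd_diamond_def)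
qed

lemma protected_quadrant:
  assumes "protected_vertex n S v" "s \<in> {1, -1}" "t \<in> {1, -1}"
  shows "\<exists>(i, j) \<in> diag ` S. s * i < s * fst (diag v) \<and> t * j < t * snd (diag v)"
proof -
  \<comment> \<open>The cone that corresponds to the quadrant given by the signs \<open>s\<close> and \<open>t\<close>.\<close>
  define k :: nat where "k = (if s = 1 then if t = 1 then 2 else 3 else if t = 1 then 1 else 0)"
  have "k < 4" by (simp add: k_def)
  then obtain c where c: "c \<in> S" "c \<in> (+) v ` cone k"
    using assms(1) unfolding protected_vertex_def by blast
  then obtain x y where xy: "\<bar>y\<bar> < x" "c = v + (rot90 ^^ k) (x, y)"
    by (auto simp: cone_def)
  have "s * fst (diag c) < s * fst (diag v) \<and> t * snd (diag c) < t * snd (diag v)"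
    using assms(2,3) xy by (auto simp: k_def rot90_def diag_def numeral_eq_Suc)
  thus ?thesis using c(1) by (intro bexI[of _ "diag c"]) (auto split: prod.splits)
qed

lemma eve_wins_if_well_hit:
  assumes S: "S \<subseteq> odd_diamond n" and n: "2 \<le> n"
    and hit: "well_hit (int (n div 2)) (2 * int n) (diag ` S)"
    and v: "v \<in> diamond n" "odd_vertex v \<or> protected_vertex n S v"
  shows "eve_wins n S v"
proof -
  define q where "q = int (n div 2)"
  have q: "0 < q" "4 * q \<le> 2 * int n" using n by (auto simp: q_def)
  have hit: "well_hit q (2 * int n) (diag ` S)" using hit by (simp add: q_def)
  have C: "diag ` S \<subseteq> odd_pts (width n) (width n)" using S odd_diamond_diag by blast
  show ?thesis
  proof (cases "odd_vertex v")
    case True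
    \<comment> \<open>The matching may avoid any even point; the origin has a closed point to its lower left in the row \<open>Y = -1\<close>.\<close>
    obtain x where x: "x \<in> {- 2 * int n<..<0}" "odd x" "(x, -1) \<in> diag ` S"
      using well_hit_row[OF hit, of "-1" "-1" "- 2 * int n" 0] n q by auto
    have "matchable (diag ` S) (odd_pts (width n) (width n)) (even_pts (width n) (width n) - {(0, 0)})"
      by (rule matchable_lower_left[OF hit q, of 0 0 x "-1"]) (use x n in auto)
    thus ?thesis using eve_wins_by_matching[OF S v(1)] True by blast
  next
    case False
    obtain a b where ab: "diag v = (a, b)" by force
    have "matchable (diag ` S) (odd_pts (width n) (width n)) (even_pts (width n) (width n) - {(a, b)})"
    proof (rule matchable_avoiding[OF hit q C])
      show "(a, b) \<in> even_pts (width n) (width n)" using even_diamond_diag v(1) False ab by metis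
      show "\<exists>(i, j) \<in> diag ` S. s * i < s * a \<and> t * j < t * b" if "s \<in> {1, -1}" "t \<in> {1, -1}" for s t
        using protected_quadrant[of n S v s t] v(2) False that ab by simp
    qed
    thus ?thesis using eve_wins_by_matching[OF S v(1)] ab by blast
  qed
qed

section \<open>The union bound\<close>

lemma prob_all_open:
  assumes T: "T \<subseteq> odd_diamond n" and p: "0 \<le> p" "p \<le> 1"
  shows "measure_pmf.prob (closed_pmf n p) {S. S \<inter> T = {}} = (1 - p) ^ card T"
proof -
  have "(\<lambda>b. {v \<in> odd_diamond n. b v}) -` {S. S \<inter> T = {}} =
      Pi (odd_diamond n) (\<lambda>x. if x \<in> T then {False} else UNIV)"
    using T by (auto simp: Pi_def split: if_splits)
  hence "measure_pmf.prob (closed_pmf n p) {S. S \<inter> T = {}} =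
      (\<Prod>x \<in> odd_diamond n. measure_pmf.prob (bernoulli_pmf p) (if x \<in> T then {False} else UNIV))"
    by (simp add: closed_pmf_def measure_Pi_pmf_Pi finite_odd_diamond)
  also have "\<dots> = (\<Prod>x \<in> odd_diamond n. if x \<in> T then 1 - p else 1)"
    using p by (intro prod.cong) (auto simp: measure_pmf_single)
  also have "\<dots> = (\<Prod>x \<in> odd_diamond n \<inter> T. 1 - p)"
    by (simp add: prod.If_cases finite_odd_diamond)
  also have "\<dots> = (1 - p) ^ card T" using T by (simp add: Int_absorb1)
  finally show ?thesis .
qed

text \<open>
  At most \<open>4 n\<close> rows and as many columns have four segments each, and a segment consists of
  \<open>n div 2\<close> odd vertices.
\<close>

lemma prob_not_well_hit:
  assumes p: "0 \<le> p" "p \<le> 1"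
  shows "measure_pmf.prob (closed_pmf n p) {S. \<not> well_hit (int (n div 2)) (2 * int n) (diag ` S)}
     \<le> 32 * real n * (1 - p) ^ (n div 2)"
proof -
  define q where "q = int (n div 2)"
  have q: "4 * q \<le> 2 * int n" by (auto simp: q_def)
  define K :: "int set" where "K = {-2, -1, 0, 1}"
  define Z where "Z = {z \<in> width n. odd z}"
  define row where "row = (\<lambda>(z, k). (\<lambda>j. undiag (2 * q * k + 2 * j + 1, z)) ` {0..<q})"
  define col where "col = (\<lambda>(z, k). (\<lambda>j. undiag (z, 2 * q * k + 2 * j + 1)) ` {0..<q})"
  define \<T> where "\<T> = row ` (Z \<times> K) \<union> col ` (Z \<times> K)"
  have "finite Z" by (rule finite_subset[of _ "width n"]) (auto simp: Z_def)
  hence fin: "finite Z" "finite K" "finite \<T>" by (auto simp: K_def \<T>_def)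
  have "card Z \<le> card (width n)" by (rule card_mono) (auto simp: Z_def)
  hence Z: "card Z \<le> 4 * n" by simp
  have K: "card K = 4" by (simp add: K_def)
  have "card \<T> \<le> card (row ` (Z \<times> K)) + card (col ` (Z \<times> K))"
    unfolding \<T>_def by (rule card_Un_le)
  also have "\<dots> \<le> card (Z \<times> K) + card (Z \<times> K)"
    using fin by (intro add_mono card_image_le) auto
  also have "\<dots> \<le> 32 * n" using Z by (simp add: card_cartesian_product K)
  finally have card_\<T>: "card \<T> \<le> 32 * n" .
  have w: "2 * q * k + 2 * j + 1 \<in> {2 * q * k<..<2 * q * (k + 1)}"
      "2 * q * k + 2 * j + 1 \<in> width n" if "k \<in> K" "j \<in> {0..<q}" for k j
    using that q by (auto simp: K_def algebra_simps)
  have du: "diag (undiag (2 * q * k + 2 * j + 1, z)) = (2 * q * k + 2 * j + 1, z)"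
       "diag (undiag (z, 2 * q * k + 2 * j + 1)) = (z, 2 * q * k + 2 * j + 1)" if "z \<in> Z" for z k j
    using that by (auto intro!: diag_undiag simp: Z_def)
  have segment: "T \<subseteq> odd_diamond n \<and> card T = n div 2" if T: "T \<in> \<T>" for T
  proof -
    from T obtain z k where zk: "z \<in> Z" "k \<in> K" and T: "T = row (z, k) \<or> T = col (z, k)"
      by (auto simp: \<T>_def)
    have "inj_on (\<lambda>j. undiag (2 * q * k + 2 * j + 1, z)) {0..<q}"
      by (rule inj_onI) (use du(1)[OF zk(1), of k] in \<open>metis Pair_inject add_left_cancel add_right_cancel mult_cancel_left zero_neq_numeral\<close>)
    moreover have "inj_on (\<lambda>j. undiag (z, 2 * q * k + 2 * j + 1)) {0..<q}"
      by (rule inj_onI) (use du(2)[OF zk(1), of k] in \<open>metis Pair_inject add_left_cancel add_right_cancel mult_cancel_left zero_neq_numeral\<close>)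
    ultimately have "card T = n div 2"
      using T by (auto simp: row_def col_def card_image q_def)
    moreover have "T \<subseteq> odd_diamond n"
      using T du[OF zk(1), of k] w(2)[OF zk(2)] zk(1)
      by (auto simp: row_def col_def odd_diamond_diag odd_pts_def Z_def)
    ultimately show ?thesis by blast
  qed
  have "{S. \<not> well_hit q (2 * int n) (diag ` S)} \<subseteq> (\<Union>T \<in> \<T>. {S. S \<inter> T = {}})"
  proof
    fix S assume "S \<in> {S. \<not> well_hit q (2 * int n) (diag ` S)}"
    then obtain z k where z: "odd z" "\<bar>z\<bar> < 2 * int n" and k: "k \<in> K"
      and no: "\<not> (\<exists>w \<in> {2 * q * k<..<2 * q * (k + 1)}. odd w \<and> (w, z) \<in> diag ` S) \<or>
          \<not> (\<exists>w \<in> {2 * q * k<..<2 * q * (k + 1)}. odd w \<and> (z, w) \<in> diag ` S)"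
      unfolding well_hit_def K_def by blast
    have zZ: "z \<in> Z" using z by (auto simp: Z_def)
    have odd: "odd (2 * q * k + 2 * j + 1)" for j by simp
    have "S \<inter> row (z, k) = {} \<or> S \<inter> col (z, k) = {}"
    proof (rule ccontr)
      assume "\<not> ?thesis"
      then obtain i j where ij: "i \<in> {0..<q}" "j \<in> {0..<q}"
        "undiag (2 * q * k + 2 * i + 1, z) \<in> S" "undiag (z, 2 * q * k + 2 * j + 1) \<in> S"
        unfolding row_def col_def case_prod_conv by blast
      hence "(2 * q * k + 2 * i + 1, z) \<in> diag ` S" "(z, 2 * q * k + 2 * j + 1) \<in> diag ` S"
        using du[OF zZ] by (metis imageI)+
      thus False using no w(1)[OF k ij(1)] w(1)[OF k ij(2)] odd by blast
    qed
    thus "S \<in> (\<Union>T \<in> \<T>. {S. S \<inter> T = {}})" using zZ k by (auto simp: \<T>_def)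
  qed
  hence "measure_pmf.prob (closed_pmf n p) {S. \<not> well_hit q (2 * int n) (diag ` S)} \<le>
      measure_pmf.prob (closed_pmf n p) (\<Union>T \<in> \<T>. {S. S \<inter> T = {}})"
    by (intro measure_pmf.finite_measure_mono) auto
  also have "\<dots> \<le> (\<Sum>T \<in> \<T>. measure_pmf.prob (closed_pmf n p) {S. S \<inter> T = {}})"
    by (rule measure_pmf.finite_measure_subadditive_finite) (use fin in auto)
  also have "\<dots> = (\<Sum>T \<in> \<T>. (1 - p) ^ (n div 2))"
    using segment prob_all_open p by (intro sum.cong) auto
  also have "\<dots> = real (card \<T>) * (1 - p) ^ (n div 2)" by simp
  also have "\<dots> \<le> real (32 * n) * (1 - p) ^ (n div 2)"
    using card_\<T> p by (intro mult_right_mono) (auto simp del: of_nat_mult)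
  finally show ?thesis by (simp add: q_def)
qed

text \<open>
  The power is at most \<open>2 exp (- p n / 2)\<close>. One factor \<open>exp (- p n / 4)\<close> of it absorbs \<open>n\<close> at the cost of
  \<open>4 / p\<close>, whatever the size of \<open>n\<close>; the other one is at most \<open>p^2\<close> by the lower bound on \<open>n\<close>.
\<close>

lemma union_bound_small:
  fixes p :: real and n :: nat
  assumes p: "0 < p" "p < 1" and n: "real n > 8 * ln (1 / p) / p"
  shows "32 * real n * (1 - p) ^ (n div 2) \<le> 256 * p"
proof -
  have half: "real (n div 2) \<ge> real n / 2 - 1 / 2" by linarith
  have "(1 - p) ^ (n div 2) \<le> exp (- p) ^ (n div 2)"
    using p exp_ge_add_one_self[of "- p"] by (intro power_mono) auto
  also have "\<dots> = exp (- p * real (n div 2))" by (metis exp_of_nat2_mult)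
  also have "\<dots> \<le> exp (1 / 2 - p * real n / 2)"
  proof -
    have "p * (real n / 2 - 1 / 2) \<le> p * real (n div 2)"
      using half p by (intro mult_left_mono) auto
    thus ?thesis using p by (simp add: algebra_simps)
  qed
  also have "\<dots> \<le> 2 * exp (- (p * real n / 2))"
  proof -
    have "exp (1 / 2 - p * real n / 2) = exp (1 / 2) * exp (- (p * real n / 2))"
      by (simp flip: exp_add)
    thus ?thesis using exp_half_le2 by simp
  qed
  finally have 1: "(1 - p) ^ (n div 2) \<le> 2 * exp (- (p * real n / 2))" .
  have "p * real n / 4 \<le> exp (p * real n / 4)"
    using exp_ge_add_one_self[of "p * real n / 4"] by linarith
  hence 2: "real n \<le> 4 / p * exp (p * real n / 4)" using p by (simp add: field_simps)
  have "2 * ln (1 / p) < p * real n / 4" using n p by (simp add: field_simps)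
  hence "exp (- (p * real n / 4)) \<le> exp (2 * ln p)" using p by (simp add: ln_div)
  also have "\<dots> = p ^ 2" using p by (metis exp_ln exp_of_nat_mult of_nat_numeral)
  finally have 3: "exp (- (p * real n / 4)) \<le> p ^ 2" .
  have "32 * real n * (1 - p) ^ (n div 2) \<le>
      32 * (4 / p * exp (p * real n / 4)) * (2 * exp (- (p * real n / 2)))"
    using 1 2 p by (intro mult_mono) auto
  also have "\<dots> = 256 / p * (exp (p * real n / 4) * exp (- (p * real n / 2)))" by simp
  also have "\<dots> = 256 / p * exp (- (p * real n / 4))"
    by (simp flip: exp_add)
  also have "\<dots> \<le> 256 / p * p ^ 2" using 3 p by (intro mult_left_mono) auto
  also have "\<dots> = 256 * p" using p by (simp add: power2_eq_square)
  finally show ?thesis .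
qed

theorem theorem3:
  "\<exists>C::real. C > 0 \<and>
     (\<forall>\<epsilon>::real. \<epsilon> > 0 \<longrightarrow>
       (\<exists>p0::real. 0 < p0 \<and> p0 < 1 \<and>
         (\<forall>(p::real) (n::nat). 0 < p \<and> p < p0 \<and> real n > C * ln (1 / p) / p \<longrightarrow>
            measure_pmf.prob (closed_pmf n p)
              {S. \<forall>v \<in> diamond n.
                 odd_vertex v \<or> (\<not> odd_vertex v \<and> protected_vertex n S v)
                   \<longrightarrow> eve_wins n S v}
            \<ge> 1 - \<epsilon>)))"
proof (rule exI[of _ 8], intro conjI allI impI)
  fix \<epsilon> :: real assume \<epsilon>: "\<epsilon> > 0"
  define p0 where "p0 = min (1 / 2) (\<epsilon> / 256)"
  show "\<exists>p0::real. 0 < p0 \<and> p0 < 1 \<and>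
         (\<forall>(p::real) (n::nat). 0 < p \<and> p < p0 \<and> real n > 8 * ln (1 / p) / p \<longrightarrow>
            measure_pmf.prob (closed_pmf n p)
              {S. \<forall>v \<in> diamond n.
                 odd_vertex v \<or> (\<not> odd_vertex v \<and> protected_vertex n S v)
                   \<longrightarrow> eve_wins n S v}
            \<ge> 1 - \<epsilon>)"
  proof (intro exI[of _ p0] conjI allI impI)
    fix p :: real and n :: nat assume "0 < p \<and> p < p0 \<and> real n > 8 * ln (1 / p) / p"
    hence p: "0 < p" "p < 1 / 2" "256 * p < \<epsilon>" and n: "real n > 8 * ln (1 / p) / p"
      by (auto simp: p0_def)
    have "ln p \<le> p - 1" using p by (intro ln_le_minus_one)
    hence "1 / 2 \<le> ln (1 / p)" using p by (simp add: ln_div)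
    hence "8 * ln (1 / p) / p \<ge> 4 / p" using p by (intro divide_right_mono) auto
    moreover have "4 / p \<ge> 4" using p by (simp add: field_simps)
    ultimately have n2: "2 \<le> n" using n by linarith
    let ?hit = "\<lambda>S. well_hit (int (n div 2)) (2 * int n) (diag ` S)"
    let ?win = "{S. \<forall>v \<in> diamond n. odd_vertex v \<or> (\<not> odd_vertex v \<and> protected_vertex n S v)
                   \<longrightarrow> eve_wins n S v}"
    let ?pr = "measure_pmf.prob (closed_pmf n p)"
    have "?pr {S. \<not> ?hit S} \<le> 256 * p"
      using prob_not_well_hit[of p n] union_bound_small[of p n] p n by simp
    hence "1 - \<epsilon> \<le> 1 - ?pr {S. \<not> ?hit S}" using p by simp
    also have "\<dots> = ?pr {S. ?hit S}"
      using measure_pmf.prob_compl[of "{S. \<not> ?hit S}" "closed_pmf n p"] 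
      by (simp add: Collect_neg_eq[symmetric] Diff_eq)
    also have "\<dots> \<le> ?pr ?win"
    proof (rule measure_pmf.finite_measure_mono_AE)
      have "S \<subseteq> odd_diamond n" if "S \<in> set_pmf (closed_pmf n p)" for S
        using that by (auto simp: closed_pmf_def)
      thus "AE S in measure_pmf (closed_pmf n p). S \<in> {S. ?hit S} \<longrightarrow> S \<in> ?win"
        using n2 by (auto simp: AE_measure_pmf_iff intro: eve_wins_if_well_hit)
    qed simp
    finally show "?pr ?win \<ge> 1 - \<epsilon>" .
  qed (use \<epsilon> in \<open>auto simp: p0_def\<close>)
qed simp

end
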